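(* For integers $n\ge 1$ and $0\le k\le n-1$, the number $g_n^{(k)}$ of leaves of $T_n$ at height $k$ is given by $$g_n^{(k)}=k!\left(k(k+1)^{n-k-1}-(k-1)k^{n-k-1}\right),$$ with the convention $0^0=1$.
   Context: $S_n$ is the set of permutations $\sigma=\sigma_1\dots\sigma_n$ of $\{1,\dots,n\}$ and $id_n=12\dots n$. The bubblesort operator $\mathbf{B}$ is one pass of the bubblesort algorithm: scan the positions from left to right, each time exchanging the current element with the one to its right whenever the latter is smaller. Equivalently, writing $\sigma=\mu_1A_1\mu_2A_2\dots\mu_rA_r$ where the $\mu_i$ are all the left-to-right maxima of $\sigma$ (elements larger than all elements to their left) and the $A_i$ are possibly empty sequences, $\mathbf{B}(\sigma)=A_1\mu_1A_2\mu_2\dots A_r\mu_r$. $T_n$ is the rooted tree whose nodes are the permutations in $S_n$, with root $id_n$, in which $\tau$ is a child of $\sigma$ if and only if $\mathbf{B}(\tau)=\sigma$ and $\sigma\ne\tau$. A leaf is a node without children (for $n=1$ the single node is a leaf). The height of a node is the number of edges on the path connecting it to the root. *)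

theory Defs
  imports Main "HOL-Combinatorics.Multiset_Permutations"
begin

text \<open>Permutations of \<open>{1..n}\<close> are written in one-line notation, as the lists in
  \<^term>\<open>permutations_of_set {1..n}\<close>.\<close>

fun bubble :: "nat list \<Rightarrow> nat list" where
  "bubble (x # y # xs) = (if y < x then y # bubble (x # xs) else x # bubble (y # xs))"
| "bubble xs = xs"

definition id_perm :: "nat \<Rightarrow> nat list" where
  "id_perm n = [1..<Suc n]"

text \<open>The tree is given by its set of edges, directed away from the root: \<open>(\<sigma>, \<tau>)\<close> is an edge
  iff \<open>\<tau>\<close> is a child of \<open>\<sigma>\<close>.\<close>

definition bubble_tree :: "nat \<Rightarrow> (nat list \<times> nat list) set" where
  "bubble_tree n = {(\<sigma>, \<tau>). \<sigma> \<in> permutations_of_set {1..n} \<and> \<tau> \<in> permutations_of_set {1..n} \<and>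
     bubble \<tau> = \<sigma> \<and> \<sigma> \<noteq> \<tau>}"

definition leaves :: "nat \<Rightarrow> nat list set" where
  "leaves n = {\<sigma> \<in> permutations_of_set {1..n}. \<nexists>\<tau>. (\<sigma>, \<tau>) \<in> bubble_tree n}"

text \<open>Existence and uniqueness of the described length, for every node, is \<open>ex1_height\<close>.\<close>

definition height :: "nat \<Rightarrow> nat list \<Rightarrow> nat" where
  "height n \<sigma> = (THE k. (id_perm n, \<sigma>) \<in> bubble_tree n ^^ k)"

lemma mset_bubble [simp]: "mset (bubble xs) = mset xs"
  by (induction xs rule: bubble.induct) auto

lemma length_bubble [simp]: "length (bubble xs) = length xs"
  by (metis mset_bubble size_mset)

lemma bubble_in_permutations [simp]:
  "bubble xs \<in> permutations_of_set A \<longleftrightarrow> xs \<in> permutations_of_set A"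
  using mset_eq_setD[OF mset_bubble, of xs] mset_eq_imp_distinct_iff[OF mset_bubble, of xs]
  by (simp add: permutations_of_set_def)

lemma bubble_lex: "bubble xs \<noteq> xs \<Longrightarrow> (bubble xs, xs) \<in> lex less_than"
  by (induction xs rule: bubble.induct) (auto split: if_splits)

lemma bubble_eq_iff_sorted: "bubble xs = xs \<longleftrightarrow> sorted xs"
proof (induction xs rule: bubble.induct)
  case (1 x y xs)
  show ?case
  proof (cases "y < x")
    case True
    then show ?thesis by auto
  next
    case False
    then have "bubble (x # y # xs) = x # y # xs \<longleftrightarrow> sorted (y # xs)"
      using 1(2) by simp
    also have "\<dots> \<longleftrightarrow> sorted (x # y # xs)"
      using False by (simp only: sorted2 not_less simp_thms)
    finally show ?thesis .
  qed
qed auto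

lemma sorted_permutation_eq_id:
  assumes "\<sigma> \<in> permutations_of_set {1..n}" "sorted \<sigma>"
  shows "\<sigma> = id_perm n"
proof (rule sorted_distinct_set_unique)
  show "set \<sigma> = set (id_perm n)"
    using permutations_of_setD(1)[OF assms(1)]
    by (simp only: id_perm_def set_upt atLeastLessThanSuc_atLeastAtMost)
qed (use assms permutations_of_setD(2)[OF assms(1)] in \<open>simp_all add: id_perm_def del: upt_Suc\<close>)

lemma ex_height:
  "\<sigma> \<in> permutations_of_set {1..n} \<Longrightarrow> \<exists>k. (id_perm n, \<sigma>) \<in> bubble_tree n ^^ k"
proof (induction \<sigma> rule: wf_induct_rule[OF wf_lex[OF wf_less_than]])
  case (1 \<sigma>)
  show ?case
  proof (cases "bubble \<sigma> = \<sigma>")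
    case True
    then have "\<sigma> = id_perm n"
      using 1(2) by (simp add: bubble_eq_iff_sorted sorted_permutation_eq_id)
    then have "(id_perm n, \<sigma>) \<in> bubble_tree n ^^ 0" by simp
    then show ?thesis ..
  next
    case False
    have "bubble \<sigma> \<in> permutations_of_set {1..n}"
      using 1(2) by (simp only: bubble_in_permutations)
    then obtain k where "(id_perm n, bubble \<sigma>) \<in> bubble_tree n ^^ k"
      using 1(1)[OF bubble_lex[OF False]] by blast
    moreover have "(bubble \<sigma>, \<sigma>) \<in> bubble_tree n"
      using False 1(2) by (auto simp: bubble_tree_def)
    ultimately have "(id_perm n, \<sigma>) \<in> bubble_tree n ^^ Suc k" by auto
    then show ?thesis ..
  qed
qed

lemma height_unique:
  "(id_perm n, \<sigma>) \<in> bubble_tree n ^^ j \<Longrightarrow> (id_perm n, \<sigma>) \<in> bubble_tree n ^^ k \<Longrightarrow> j = k"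
proof (induction j arbitrary: k \<sigma>)
  case 0
  have "bubble (id_perm n) = id_perm n"
    by (simp add: bubble_eq_iff_sorted id_perm_def del: upt_Suc)
  with 0 show ?case by (cases k) (auto simp: bubble_tree_def)
next
  case (Suc j)
  have id: "bubble (id_perm n) = id_perm n"
    by (simp add: bubble_eq_iff_sorted id_perm_def del: upt_Suc)
  from Suc.prems(1) have *: "(id_perm n, bubble \<sigma>) \<in> bubble_tree n ^^ j" "bubble \<sigma> \<noteq> \<sigma>"
    by (auto simp: bubble_tree_def)
  with id have "\<sigma> \<noteq> id_perm n" by auto
  with Suc.prems(2) obtain k' where k: "k = Suc k'" by (cases k) auto
  with Suc.prems(2) have "(id_perm n, bubble \<sigma>) \<in> bubble_tree n ^^ k'"
    by (auto simp: bubble_tree_def)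
  with Suc.IH * k show ?case by blast
qed

lemma ex1_height:
  "\<sigma> \<in> permutations_of_set {1..n} \<Longrightarrow> \<exists>!k. (id_perm n, \<sigma>) \<in> bubble_tree n ^^ k"
  using ex_height height_unique by blast

end

theory Submission imports Defs begin

text \<open>For an entry of a permutation, count the larger entries to its left. One bubblesort pass
  lowers every positive count by one, so the height of \<open>\<sigma>\<close> in the tree is the largest count.
  Building a permutation from its last entry backwards, the last entry may be any of the \<open>k + 1\<close>
  largest available ones if all counts are to be at most \<open>k\<close>; this gives
  \<open>k! (k + 1)\<^sup>n\<^sup>-\<^sup>k\<close> permutations of height at most \<open>k\<close>. For \<open>n \<ge> 2\<close> the leaves are the permutations
  not ending in \<open>n\<close>.\<close>

section \<open>Bounded left-inversion counts and the effect of one pass\<close>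

text \<open>\<open>M\<close> collects the entries to the left of the list.\<close>

fun inv_le :: "nat \<Rightarrow> 'a::linorder multiset \<Rightarrow> 'a list \<Rightarrow> bool" where
  "inv_le k M [] \<longleftrightarrow> True"
| "inv_le k M (x # xs) \<longleftrightarrow> size {#y \<in># M. x < y#} \<le> k \<and> inv_le k (add_mset x M) xs"

lemma inv_le_append:
  "inv_le k M (xs @ ys) \<longleftrightarrow> inv_le k M xs \<and> inv_le k (mset xs + M) ys"
  by (induction xs arbitrary: M) auto

lemma inv_le_snoc:
  "inv_le k {#} (xs @ [x]) \<longleftrightarrow> inv_le k {#} xs \<and> size {#y \<in># mset xs. x < y#} \<le> k"
  by (simp add: inv_le_append)

lemma inv_le_0_iff_sorted: "inv_le 0 {#} xs \<longleftrightarrow> sorted xs"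
proof (induction xs rule: rev_induct)
  case (snoc x xs)
  have "{#y \<in># mset xs. x < y#} = {#} \<longleftrightarrow> (\<forall>y\<in>set xs. y \<le> x)"
    by (auto simp: not_less)
  with snoc show ?case
    by (simp add: inv_le_snoc sorted_append)
qed simp

lemma filter_greater_max: "\<forall>y\<in>#M. y \<le> x \<Longrightarrow> {#y \<in># M. x < y#} = {#}"
  for x :: "'a::linorder"
  by (auto simp: not_less)

text \<open>During the pass, \<open>x\<close> is the entry being carried, hence a maximum of those seen so far.\<close>

lemma inv_le_bubble_Cons:
  assumes "\<forall>y\<in>#M. y \<le> x"
  shows "inv_le k M (bubble (x # xs)) \<longleftrightarrow> inv_le (Suc k) (add_mset x M) xs"
  using assms
proof (induction xs arbitrary: x M)
  case Nil
  then show ?case by (simp add: filter_greater_max)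
next
  case (Cons y xs)
  show ?case
  proof (cases "y < x")
    case True
    \<comment> \<open>\<open>y\<close> is output before \<open>x\<close>, so its count loses exactly
      the contribution of \<open>x\<close>, which stays in hand.\<close>
    with Cons.prems show ?thesis
      by (simp add: Cons.IH add_mset_commute)
  next
    case False
    then have "\<forall>z\<in>#add_mset x M. z \<le> y"
      using Cons.prems by auto
    \<comment> \<open>\<open>x\<close> is put down and \<open>y\<close> is picked up; both have
      count zero, so neither constrains the bound.\<close>
    then show ?thesis
      using False Cons.prems by (simp add: Cons.IH filter_greater_max)
  qed
qed

text \<open>The first entry is carried over the empty \<open>M\<close>, and its own count is
  zero.\<close>

lemma inv_le_bubble: "inv_le k {#} (bubble xs) \<longleftrightarrow> inv_le (Suc k) {#} xs"
  by (cases xs) (simp_all add: inv_le_bubble_Cons)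

section \<open>Height in the tree as the largest count\<close>

lemma bubble_id_perm [simp]: "bubble (id_perm n) = id_perm n"
  by (simp add: bubble_eq_iff_sorted id_perm_def del: upt_Suc)

lemma height_eqI: "(id_perm n, \<sigma>) \<in> bubble_tree n ^^ k \<Longrightarrow> height n \<sigma> = k"
  unfolding height_def by (blast intro: height_unique)

lemma relpow_height:
  "\<sigma> \<in> permutations_of_set {1..n} \<Longrightarrow> (id_perm n, \<sigma>) \<in> bubble_tree n ^^ height n \<sigma>"
  using ex_height height_eqI by blast

lemma height_id_perm [simp]: "height n (id_perm n) = 0"
  by (rule height_eqI) simp

text \<open>Below the root, \<open>bubble\<close> steps to the parent. It fixes the root, where
  truncated subtraction keeps the height at 0.\<close>

lemma height_bubble:
  assumes "\<sigma> \<in> permutations_of_set {1..n}"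
  shows "height n (bubble \<sigma>) = height n \<sigma> - 1"
proof (cases "height n \<sigma>")
  case 0
  with relpow_height[OF assms] have "\<sigma> = id_perm n" by simp
  then show ?thesis by simp
next
  case (Suc j)
  with relpow_height[OF assms] have "(id_perm n, bubble \<sigma>) \<in> bubble_tree n ^^ j"
    by (auto simp: bubble_tree_def)
  with Suc show ?thesis by (simp add: height_eqI)
qed

text \<open>One pass shifts the bound by one on both sides, and only the identity meets the bound
  0.\<close>

lemma height_le_iff:
  assumes "\<sigma> \<in> permutations_of_set {1..n}"
  shows "height n \<sigma> \<le> k \<longleftrightarrow> inv_le k {#} \<sigma>"
  using assms
proof (induction k arbitrary: \<sigma>)
  case 0
  have "height n \<sigma> = 0 \<longleftrightarrow> \<sigma> = id_perm n"
    using relpow_height[OF 0] by auto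
  also have "\<dots> \<longleftrightarrow> sorted \<sigma>"
    using sorted_permutation_eq_id[OF 0] bubble_eq_iff_sorted bubble_id_perm by metis
  finally show ?case by (simp add: inv_le_0_iff_sorted)
next
  case (Suc k)
  have "height n \<sigma> \<le> Suc k \<longleftrightarrow> height n (bubble \<sigma>) \<le> k"
    using height_bubble[OF Suc.prems] by auto
  also have "\<dots> \<longleftrightarrow> inv_le (Suc k) {#} \<sigma>"
    using Suc by (simp add: inv_le_bubble)
  finally show ?case .
qed

section \<open>Characterisation of the leaves\<close>

lemma last_bubble: "xs \<noteq> [] \<Longrightarrow> last (bubble xs) = Max (set xs)"
proof (induction xs rule: bubble.induct)
  case (1 x y xs)
  have ne: "bubble (z # zs) \<noteq> []" for z zs
    using length_bubble[of "z # zs"] by fastforce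
  have "Max (insert x (insert y (set xs))) = Max (insert (max x y) (set xs))"
    by (cases "xs = []") (simp_all add: max.assoc)
  then show ?case
    using 1 ne by (auto simp: max_def)
qed auto

lemma bubble_Cons_max: "\<forall>y\<in>set xs. y < x \<Longrightarrow> bubble (x # xs) = xs @ [x]"
  by (induction xs) auto

text \<open>A pass carries \<open>n\<close> to the end; conversely, moving a final \<open>n\<close>
  to the front gives a child. For \<open>n = 1\<close> that move changes nothing, so the single node
  is a leaf although it ends in \<open>n\<close>.\<close>

lemma leaves_eq:
  assumes "n \<ge> 2"
  shows "leaves n = {\<sigma> \<in> permutations_of_set {1..n}. last \<sigma> \<noteq> n}"
proof -
  have "(\<exists>\<tau>. (\<sigma>, \<tau>) \<in> bubble_tree n) \<longleftrightarrow> last \<sigma> = n"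
    if \<sigma>: "\<sigma> \<in> permutations_of_set {1..n}" for \<sigma>
  proof
    assume "\<exists>\<tau>. (\<sigma>, \<tau>) \<in> bubble_tree n"
    then obtain \<tau> where \<tau>: "\<tau> \<in> permutations_of_set {1..n}" "bubble \<tau> = \<sigma>"
      by (auto simp: bubble_tree_def)
    have "set \<tau> = {1..n}" using permutations_of_setD(1)[OF \<tau>(1)] .
    moreover from this have "\<tau> \<noteq> []" using assms by auto
    moreover have "Max {1..n} = n" using assms by (intro Max_eqI) auto
    ultimately show "last \<sigma> = n" using last_bubble[of \<tau>] \<tau>(2) by simp
  next
    assume last: "last \<sigma> = n"
    have set: "set \<sigma> = {1..n}" and dist: "distinct \<sigma>"
      using permutations_of_setD[OF \<sigma>] by auto
    from set have "\<sigma> \<noteq> []" using assms by auto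
    with last obtain xs where xs: "\<sigma> = xs @ [n]"
      by (metis append_butlast_last_id)
    have less: "\<forall>y\<in>set xs. y < n"
    proof
      fix y assume "y \<in> set xs"
      with xs set dist have "y \<in> {1..n}" "y \<noteq> n" by auto
      then show "y < n" by simp
    qed
    \<comment> \<open>The preimage \<open>n # xs\<close> must differ from \<open>\<sigma>\<close>:
      some entry other than \<open>n\<close> has to precede it.\<close>
    have "1 \<in> set \<sigma>" using set assms by simp
    with xs assms have "xs \<noteq> []" by auto
    with less have "n # xs \<noteq> \<sigma>" by (cases xs) (auto simp: xs)
    moreover have "bubble (n # xs) = \<sigma>" using bubble_Cons_max[OF less] xs by simp
    moreover from this have "n # xs \<in> permutations_of_set {1..n}"
      using \<sigma> bubble_in_permutations by metis
    ultimately have "(\<sigma>, n # xs) \<in> bubble_tree n"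
      using \<sigma> by (auto simp: bubble_tree_def)
    then show "\<exists>\<tau>. (\<sigma>, \<tau>) \<in> bubble_tree n" ..
  qed
  then show ?thesis by (auto simp: leaves_def)
qed

section \<open>Counting permutations with bounded counts\<close>

text \<open>General sets \<open>A\<close> are allowed because deleting the last entry from a
  permutation of an interval need not leave an interval.\<close>

definition inv_le_perms :: "nat \<Rightarrow> 'a::linorder set \<Rightarrow> 'a list set" where
  "inv_le_perms k A = {xs \<in> permutations_of_set A. inv_le k {#} xs}"

lemma finite_inv_le_perms [simp]: "finite (inv_le_perms k A)"
  by (simp add: inv_le_perms_def)

text \<open>All other elements of \<open>A\<close> stand to the left of the last entry, so its count
  depends on \<open>A\<close> alone and not on their order.\<close>

lemma snoc_in_inv_le_perms_iff:
  "xs @ [x] \<in> inv_le_perms k A \<longleftrightarrow>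
    x \<in> A \<and> card {y \<in> A. x < y} \<le> k \<and> xs \<in> inv_le_perms k (A - {x})"
proof -
  have "size {#y \<in># mset xs. x < y#} = card {y \<in> A. x < y}"
    if "distinct xs" "set xs = A - {x}"
  proof -
    have "size {#y \<in># mset xs. x < y#} = length (filter ((<) x) xs)"
      by (simp flip: mset_filter)
    also have "\<dots> = card (set (filter ((<) x) xs))"
      using that by (intro distinct_card[symmetric] distinct_filter)
    also have "set (filter ((<) x) xs) = {y \<in> A. x < y}"
      using that by auto
    finally show ?thesis .
  qed
  moreover have "set (xs @ [x]) = A \<and> distinct (xs @ [x]) \<longleftrightarrow>
      x \<in> A \<and> set xs = A - {x} \<and> distinct xs"
    by auto
  ultimately show ?thesis
    unfolding inv_le_perms_def permutations_of_set_def mem_Collect_eq inv_le_snoc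
    by (metis (lifting))
qed

lemma card_inv_le_perms_last:
  assumes "x \<in> A" "card {y \<in> A. x < y} \<le> k"
  shows "card {xs \<in> inv_le_perms k A. last xs = x} = card (inv_le_perms k (A - {x}))"
proof -
  have "xs \<in> (\<lambda>ys. ys @ [x]) ` inv_le_perms k (A - {x})"
    if "xs \<in> inv_le_perms k A" "last xs = x" for xs
  proof -
    have "xs \<noteq> []"
      using that assms by (auto simp: inv_le_perms_def permutations_of_set_def)
    with that obtain ys where "xs = ys @ [x]" by (metis append_butlast_last_id)
    with that show ?thesis by (simp add: snoc_in_inv_le_perms_iff)
  qed
  then have "{xs \<in> inv_le_perms k A. last xs = x} = (\<lambda>ys. ys @ [x]) ` inv_le_perms k (A - {x})"
    using assms by (auto simp: snoc_in_inv_le_perms_iff)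
  then show ?thesis by (simp add: card_image inj_on_def)
qed

text \<open>This is the rank from the top, starting at 0: strictly decreasing in \<open>x\<close>,
  hence injective, and below \<open>card A\<close> as \<open>x\<close> does not count
  itself.\<close>

lemma bij_betw_card_greater:
  fixes A :: "'a::linorder set"
  assumes "finite A"
  shows "bij_betw (\<lambda>x. card {y \<in> A. x < y}) A {..<card A}"
proof -
  have "card {y \<in> A. z < y} < card {y \<in> A. x < y}" if "x < z" "z \<in> A" for x z
    using that assms by (intro psubset_card_mono) auto
  then have "inj_on (\<lambda>x. card {y \<in> A. x < y}) A"
    by (intro linorder_inj_onI) fastforce+
  moreover have "card {y \<in> A. x < y} < card A" if "x \<in> A" for x
    using that assms by (intro psubset_card_mono) auto
  then have "(\<lambda>x. card {y \<in> A. x < y}) ` A \<subseteq> {..<card A}" by auto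
  ultimately show ?thesis
    by (simp add: bij_betw_def card_image card_subset_eq)
qed

lemma card_few_greater:
  fixes A :: "'a::linorder set"
  assumes "finite A"
  shows "card {x \<in> A. card {y \<in> A. x < y} \<le> k} = min (card A) (Suc k)"
proof -
  let ?f = "\<lambda>x. card {y \<in> A. x < y}"
  have "?f ` A = {..<card A}" "inj_on ?f A"
    using bij_betw_card_greater[OF assms] by (auto simp: bij_betw_def)
  moreover have "?f ` {x \<in> A. ?f x \<le> k} = ?f ` A \<inter> {..k}" by auto
  ultimately have image: "?f ` {x \<in> A. ?f x \<le> k} = {..<min (card A) (Suc k)}"
    by auto
  have "inj_on ?f {x \<in> A. ?f x \<le> k}"
    using \<open>inj_on ?f A\<close> by (rule inj_on_subset) auto
  from card_image[OF this] show ?thesis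
    unfolding image by simp
qed

text \<open>Each choice of last entry leaves a set of size \<open>card A - 1\<close>, so the factor
  \<open>min (card A) (Suc k)\<close> splits off.\<close>

lemma card_inv_le_perms:
  assumes "finite A"
  shows "card (inv_le_perms k A) = (\<Prod>i=1..card A. min i (Suc k))"
  using assms
proof (induction "card A" arbitrary: A)
  case 0
  then have "inv_le_perms k A = {[]}" by (auto simp: inv_le_perms_def)
  then show ?case using 0 by simp
next
  case (Suc m)
  let ?X = "{x \<in> A. card {y \<in> A. x < y} \<le> k}"
  have "\<exists>x\<in>?X. last xs = x" if "xs \<in> inv_le_perms k A" for xs
  proof -
    have "xs \<noteq> []"
      using that Suc.hyps(2) by (auto simp: inv_le_perms_def permutations_of_set_def)
    then obtain ys x where "xs = ys @ [x]" by (metis append_butlast_last_id)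
    with that show ?thesis by (simp add: snoc_in_inv_le_perms_iff)
  qed
  then have "inv_le_perms k A = (\<Union>x\<in>?X. {xs \<in> inv_le_perms k A. last xs = x})"
    by auto
  then have "card (inv_le_perms k A) =
      card (\<Union>x\<in>?X. {xs \<in> inv_le_perms k A. last xs = x})"
    by simp
  also have "\<dots> = (\<Sum>x\<in>?X. card {xs \<in> inv_le_perms k A. last xs = x})"
    using Suc.prems by (intro card_UN_disjoint) auto
  also have "\<dots> = (\<Sum>x\<in>?X. (\<Prod>i=1..m. min i (Suc k)))"
  proof (rule sum.cong)
    fix x assume x: "x \<in> ?X"
    then have "m = card (A - {x})" using Suc by simp
    with x Suc show "card {xs \<in> inv_le_perms k A. last xs = x} = (\<Prod>i=1..m. min i (Suc k))"
      by (simp add: card_inv_le_perms_last)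
  qed simp
  also have "\<dots> = (\<Prod>i=1..card A. min i (Suc k))"
    using Suc.prems by (simp add: card_few_greater flip: Suc.hyps(2))
  finally show ?case .
qed

section \<open>Closed forms and the count of leaves\<close>

text \<open>The first \<open>k\<close> factors form the factorial; the other \<open>n - k\<close>
  all equal \<open>Suc k\<close>.\<close>

lemma prod_min_eq:
  assumes "k \<le> n"
  shows "(\<Prod>i=1..n. min i (Suc k)) = fact k * Suc k ^ (n - k)"
  using assms
proof (induction n rule: dec_induct)
  case base
  have "(\<Prod>i=1..k. min i (Suc k)) = \<Prod>{1..k}" by (rule prod.cong) auto
  then show ?case by (simp add: fact_prod)
next
  case (step n)
  then show ?case by (simp add: Suc_diff_le algebra_simps)
qed

lemma card_leaves_height_le:
  assumes "n \<ge> 2" "k \<le> n - 1"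
  shows "card {\<sigma> \<in> leaves n. height n \<sigma> \<le> k} = k * fact k * Suc k ^ (n - k - 1)"
proof -
  let ?S = "inv_le_perms k {1..n}" and ?T = "{xs \<in> inv_le_perms k {1..n}. last xs = n}"
  have "{\<sigma> \<in> leaves n. height n \<sigma> \<le> k} = ?S - ?T"
    using assms(1) by (auto simp: leaves_eq inv_le_perms_def height_le_iff)
  moreover have "card (?S - ?T) = card ?S - card ?T"
    by (rule card_Diff_subset) (auto intro: finite_subset[OF _ finite_inv_le_perms])
  moreover have "card ?S = fact k * Suc k ^ (n - k)"
    using assms prod_min_eq[of k n] by (simp add: card_inv_le_perms)
  moreover have "card ?T = fact k * Suc k ^ (n - k - 1)"
  proof -
    \<comment> \<open>A final \<open>n\<close> has count zero, so it is admissible for every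
      \<open>k\<close> and can be deleted.\<close>
    have none: "{y \<in> {1..n}. n < y} = {}" by auto
    have "card ?T = card (inv_le_perms k ({1..n} - {n}))"
      using assms by (intro card_inv_le_perms_last) (simp, simp only: none card.empty)
    also have "\<dots> = card (inv_le_perms k {1..n - 1})"
    proof -
      have "{1..n} - {n} = {1..n - 1}" using assms by auto
      then show ?thesis by simp
    qed
    also have "\<dots> = fact k * Suc k ^ (n - 1 - k)"
      using assms prod_min_eq[of k "n - 1"] by (simp add: card_inv_le_perms)
    finally show ?thesis by (simp add: diff_commute)
  qed
  \<comment> \<open>With this factor split off, the difference has the coefficient
    \<open>Suc k - 1 = k\<close>.\<close>
  moreover have "Suc k ^ (n - k) = Suc k * Suc k ^ (n - k - 1)"
    using assms by (subst power_Suc[symmetric]) (simp add: Suc_diff_Suc)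
  ultimately show ?thesis by (simp add: algebra_simps)
qed

lemma card_leaves_1: "card {\<sigma> \<in> leaves (Suc 0). height (Suc 0) \<sigma> = 0} = Suc 0"
proof -
  have "permutations_of_set {Suc 0} = {id_perm (Suc 0)}"
    by (simp add: id_perm_def)
  then have "leaves (Suc 0) = {id_perm (Suc 0)}"
    by (auto simp: leaves_def bubble_tree_def)
  then have "{\<sigma> \<in> leaves (Suc 0). height (Suc 0) \<sigma> = 0} = {id_perm (Suc 0)}"
    using height_id_perm[of "Suc 0"] by blast
  then show ?thesis by simp
qed

theorem corollary4p8:
  fixes n k :: nat
  assumes "n \<ge> 1" and "k \<le> n - 1"
  shows "int (card {\<sigma> \<in> leaves n. height n \<sigma> = k}) =
    fact k * (int k * (int k + 1) ^ (n - k - 1) - (int k - 1) * int k ^ (n - k - 1))"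
proof (cases "n = 1")
  case True
  with assms have "k = 0" by simp
  \<comment> \<open>The formula evaluates to 1 here only because \<open>0 ^ 0 = 1\<close>.\<close>
  with True show ?thesis using card_leaves_1 by simp
next
  case False
  with assms have n: "n \<ge> 2" by simp
  show ?thesis
  proof (cases k)
    case 0
    \<comment> \<open>The exponent \<open>n - 1\<close> is positive, so both sides vanish.\<close>
    then show ?thesis using card_leaves_height_le[of n 0] n by simp
  next
    case (Suc j)
    \<comment> \<open>The leaves of height exactly \<open>k\<close> come from the difference of the
      cumulative counts for \<open>k\<close> and \<open>j = k - 1\<close>.\<close>
    let ?L = "\<lambda>k. {\<sigma> \<in> leaves n. height n \<sigma> \<le> k}"
    have "?L k = {\<sigma> \<in> leaves n. height n \<sigma> = k} \<union> ?L j"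
      using Suc by auto
    moreover have "{\<sigma> \<in> leaves n. height n \<sigma> = k} \<inter> ?L j = {}"
      using Suc by auto
    moreover have "finite {\<sigma> \<in> leaves n. height n \<sigma> = k}" "finite (?L j)"
      by (simp_all add: leaves_def)
    ultimately have "card (?L k) = card {\<sigma> \<in> leaves n. height n \<sigma> = k} + card (?L j)"
      by (simp only: card_Un_disjoint)
    then have "int (card {\<sigma> \<in> leaves n. height n \<sigma> = k}) = int (card (?L k)) - int (card (?L j))"
      by simp
    also have "card (?L k) = k * fact k * Suc k ^ (n - k - 1)"
      using n assms(2) by (rule card_leaves_height_le)
    also have "card (?L j) = j * fact j * Suc j ^ (n - j - 1)"
      using n assms(2) Suc by (intro card_leaves_height_le) simp_all
    \<comment> \<open>The extra factor \<open>Suc j = k\<close> of the power turns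
      \<open>fact j\<close> into \<open>fact k\<close>, which both terms then share.\<close>
    also have "n - j - 1 = Suc (n - k - 1)"
      using Suc assms n by simp
    finally show ?thesis
      by (simp add: Suc algebra_simps)
  qed
qed

end
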